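(* Let $G\in\varepsilon_{13}$. Then no two cycles of $G$ intersect in a path $P_t$ with $t>0$ edges.
   Context: All graphs are finite, simple and connected. An Euler graph is a connected graph all of whose nodes have even degree. $\varepsilon_{13}$ is the class of Euler graphs in which every cycle has length $\equiv 1$ or $\equiv 3\pmod 4$ and which contain at least one cycle of each of these two kinds. *)

theory Defs
  imports "Graph_Theory.Graph_Theory"
begin

text \<open>
  A finite simple graph is a \<^locale>\<open>pair_graph\<close>: each undirected edge is the pair of arcs
  \<open>(u,v)\<close>, \<open>(v,u)\<close>. The degree of a vertex is therefore its out-degree.
\<close>

definition euler_graph :: "'a pair_pre_digraph \<Rightarrow> bool" where
  "euler_graph G \<longleftrightarrow>
     pair_graph G \<and> connected (with_proj G) \<and> (\<forall>v \<in> pverts G. even (out_degree (with_proj G) v))"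

text \<open>The undirected graph traversed by the arc walk \<open>p\<close> starting in \<open>u\<close>.\<close>

definition walk_graph :: "'a \<Rightarrow> ('a \<times> 'a) awalk \<Rightarrow> 'a pair_pre_digraph" where
  "walk_graph u p = \<lparr> pverts = set (pawalk_verts u p), parcs = set p \<union> (set p)\<inverse> \<rparr>"

text \<open>
  Cycles and paths are subgraphs, so the starting vertex and the orientation of the traversing walk
  do not matter; the first argument is the number of edges. The condition \<open>3 \<le> n\<close> excludes the
  directed cycles \<open>u,v,u\<close> along a single edge, which count as cycles for
  \<^const>\<open>pre_digraph.cycle\<close>.
\<close>

definition cycle_in :: "nat \<Rightarrow> 'a pair_pre_digraph \<Rightarrow> 'a pair_pre_digraph \<Rightarrow> bool" where
  "cycle_in n C G \<longleftrightarrow> 3 \<le> n \<and>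
     (\<exists>u p. pre_digraph.awalk (with_proj G) u p u \<and> pre_digraph.cycle (with_proj G) p
        \<and> length p = n \<and> C = walk_graph u p)"

definition path_in :: "nat \<Rightarrow> 'a pair_pre_digraph \<Rightarrow> 'a pair_pre_digraph \<Rightarrow> bool" where
  "path_in t P G \<longleftrightarrow>
     (\<exists>u p v. pre_digraph.apath (with_proj G) u p v \<and> length p = t \<and> P = walk_graph u p)"

definition graph_inter ::
  "'a pair_pre_digraph \<Rightarrow> 'a pair_pre_digraph \<Rightarrow> 'a pair_pre_digraph" where
  "graph_inter C D = \<lparr> pverts = pverts C \<inter> pverts D, parcs = parcs C \<inter> parcs D \<rparr>"

definition eps13 :: "'a pair_pre_digraph set" where
  "eps13 = {G. euler_graph G
     \<and> (\<forall>n C. cycle_in n C G \<longrightarrow> n mod 4 = 1 \<or> n mod 4 = 3)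
     \<and> (\<exists>n C. cycle_in n C G \<and> n mod 4 = 1)
     \<and> (\<exists>n C. cycle_in n C G \<and> n mod 4 = 3)}"

end

theory Submission
  imports Defs
begin

text \<open>
  If two distinct cycles meet exactly in a path with at least one edge, the complements of
  that path in the two cycles share only their ends and together form a third cycle (they cannot
  both be the single edge joining these ends, as the cycles are distinct). Its length is
  \<open>m + n - 2 * t\<close>, which is even since \<open>m\<close> and \<open>n\<close> are odd; but every cycle of the graph is odd.
\<close>

section \<open>Heads, tails and reversal of arc walks\<close>

lemma pawalk_verts_eq_Cons:
  "pcas u p v \<Longrightarrow> pawalk_verts u p = u # map snd p"
  by (induct p arbitrary: u) auto

text \<open>Both sides list the vertices visited, with multiplicity. For a closed walk, tails and
  heads thus agree as multisets, so distinctness passes from one to the other.\<close>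

lemma mset_tails_heads:
  "pcas u p v \<Longrightarrow> add_mset v (mset (map fst p)) = add_mset u (mset (map snd p))"
  by (induct p arbitrary: u) (auto simp: add_mset_commute)

lemma rev_path_conv: "rev_path p = map prod.swap (rev p)"
  by (induct p) (auto simp: prod.swap_def)

lemma set_rev_path: "set (rev_path p) = (set p)\<inverse>"
  by (induct p) auto

text \<open>The start is also the head of the last arc. The subgraph therefore depends on the set of
  arcs only, which makes it invariant under rotation.\<close>

lemma walk_graph_closed:
  assumes "pcas u p u" "p \<noteq> []"
  shows "walk_graph u p = \<lparr> pverts = snd ` set p, parcs = set p \<union> (set p)\<inverse> \<rparr>"
proof -
  have "u \<in> snd ` set p"
    using assms(2) mset_tails_heads[OF assms(1)] assms(1)
    by (cases p) (auto dest!: arg_cong[of _ _ set_mset])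
  then show ?thesis
    using assms by (auto simp: walk_graph_def pawalk_verts_eq_Cons)
qed

section \<open>Cycles as closed walks with distinct heads\<close>

context pair_sym_digraph
begin

text \<open>The vertex list without its first entry is the list of heads, whatever the start. Being
  a cycle thus becomes a condition on the arcs that rotation clearly preserves.\<close>

lemma cycle_conv_heads:
  assumes "awalk u p u"
  shows "cycle p \<longleftrightarrow> p \<noteq> [] \<and> distinct (map snd p)"
proof -
  have eq: "pawalk_verts u p = u # map snd p"
    using assms by (auto simp: awalk_def pawalk_verts_eq_Cons)
  show ?thesis
  proof
    assume "cycle p"
    then obtain w where "awalk w p w" "distinct (tl (pawalk_verts w p))" "p \<noteq> []"
      by (auto simp: cycle_def)
    then show "p \<noteq> [] \<and> distinct (map snd p)"
      by (auto simp: awalk_def pawalk_verts_eq_Cons)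
  next
    assume "p \<noteq> [] \<and> distinct (map snd p)"
    then show "cycle p"
      using assms eq by (auto simp: cycle_def)
  qed
qed

lemma distinct_tails_if_cycle:
  assumes "awalk u p u" "cycle p"
  shows "distinct (map fst p)"
proof -
  have "mset (map fst p) = mset (map snd p)"
    using assms(1) mset_tails_heads[of u p u] by (auto simp: awalk_def)
  then show ?thesis
    using assms cycle_conv_heads by (metis mset_eq_imp_distinct_iff)
qed

lemma cycle_rev_path:
  assumes "awalk u p u" "cycle p"
  shows "cycle (rev_path p)"
proof -
  have "map snd (rev_path p) = rev (map fst p)"
    by (simp add: rev_path_conv rev_map)
  then show ?thesis
    using assms cycle_conv_heads[of u "rev_path p"] distinct_tails_if_cycle[OF assms]
    by (auto simp: cycle_conv_heads)
qed

lemma walk_graph_rev_path: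
  assumes "awalk u p u" "p \<noteq> []"
  shows "walk_graph u (rev_path p) = walk_graph u p"
proof -
  have "mset (map fst p) = mset (map snd p)"
    using assms(1) mset_tails_heads[of u p u] by (auto simp: awalk_def)
  then have "fst ` set p = snd ` set p"
    by (metis list.set_map mset_eq_setD)
  moreover have "awalk u (rev_path p) u" using assms by simp
  moreover have "snd ` set (rev_path p) = fst ` set p"
    by (force simp: rev_path_conv image_iff)
  ultimately show ?thesis
    using assms by (auto simp: walk_graph_closed awalk_def set_rev_path)
qed

lemma cycle_rotate_to_arc:
  assumes "awalk u p u" "cycle p" "e \<in> set p"
  obtains r where "awalk (fst e) (e # r) (fst e)" "cycle (e # r)"
    "length (e # r) = length p" "walk_graph (fst e) (e # r) = walk_graph u p"
proof -
  obtain p1 p2 where p: "p = p1 @ e # p2"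
    using assms(3) by (auto simp: in_set_conv_decomp)
  have w: "awalk (fst e) (e # p2 @ p1) (fst e)"
    using assms(1) unfolding p by (auto simp: awalk_Cons_iff)
  moreover have "cycle (e # p2 @ p1)"
    using assms(2) unfolding cycle_conv_heads[OF w] cycle_conv_heads[OF assms(1)] by (auto simp: p)
  moreover have "walk_graph (fst e) (e # p2 @ p1) = walk_graph u p"
    using w assms(1) p walk_graph_closed[of u p] walk_graph_closed[of "fst e" "e # p2 @ p1"]
    by (auto simp: awalk_def)
  ultimately show ?thesis
    using that[of "p2 @ p1"] p by simp
qed

text \<open>The cycle may traverse the edge in the opposite direction; then the reversed cycle,
  which has the same \<open>walk_graph\<close>, is rotated instead.\<close>

lemma cycle_start_with_edge:
  assumes "awalk u p u" "cycle p" "e \<in> set p \<union> (set p)\<inverse>"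
  obtains r where "awalk (fst e) (e # r) (fst e)" "cycle (e # r)"
    "length (e # r) = length p" "walk_graph (fst e) (e # r) = walk_graph u p"
proof (cases "e \<in> set p")
  case True
  then show ?thesis using cycle_rotate_to_arc assms that by blast
next
  case False
  then have "e \<in> set (rev_path p)"
    using assms(3) by (simp add: set_rev_path)
  moreover have "p \<noteq> []" using assms(1,2) cycle_conv_heads by blast
  moreover have "length (rev_path p) = length p" by (simp add: rev_path_conv)
  moreover have "awalk u (rev_path p) u" using assms(1) by simp
  ultimately show ?thesis
    using cycle_rotate_to_arc[OF _ cycle_rev_path[OF assms(1,2)]] that
      walk_graph_rev_path[OF assms(1)] by metis
qed

section \<open>Splitting a cycle along a path and joining the complements\<close>

text \<open>
  At each inner vertex of the path, the cycle offers only two edges, and the one just traversed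
  cannot be reused.
\<close>

lemma path_prefix_of_cycle:
  assumes "awalk a p a" "cycle p" "p = e # p'"
    and "apath a (e # q) b" "set (e # q) \<subseteq> set p \<union> (set p)\<inverse>"
  shows "\<exists>r. p = (e # q) @ r"
  using assms(4,5)
proof (induct q arbitrary: b rule: rev_induct)
  case Nil
  then show ?case using assms(3) by simp
next
  case (snoc f q)
  have dp: "distinct (map snd p)" "distinct (map fst p)"
    using assms(1,2) cycle_conv_heads distinct_tails_if_cycle by blast+
  let ?q = "e # q" and ?x = "snd (last (e # q))"
  have wqf: "awalk a (?q @ [f]) b" and dist: "distinct (a # map snd (?q @ [f]))"
    using snoc.prems(1) pawalk_verts_eq_Cons[of a "?q @ [f]" b]
    by (auto simp: apath_def awalk_def)
  have last: "pawalk_verts a ?q = a # map snd ?q" "last (pawalk_verts a ?q) = ?x"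
    if "awalk a ?q w" for w
    using that pawalk_verts_eq_Cons[of a ?q w] by (auto simp: awalk_def last_map)
  have wq: "awalk a ?q ?x" and f: "fst f = ?x"
  proof -
    have 1: "awalk a ?q (last (pawalk_verts a ?q))" "awalk (last (pawalk_verts a ?q)) [f] b"
      using wqf by (simp_all only: awalk_append_iff)
    then show "awalk a ?q ?x" "fst f = ?x" using last(2)[OF 1(1)] by (auto simp: awalk_Cons_iff)
  qed
  have "apath a ?q ?x"
    using wq dist last(1)[OF wq] by (auto simp: apath_def)
  then obtain r where r: "p = ?q @ r"
    using snoc by fastforce
  \<comment> \<open>Otherwise the cycle would already have closed at \<open>a\<close>, while the
    longer path still avoids returning there.\<close>
  have "r \<noteq> []"
  proof
    assume "r = []"
    then have "?x = a" using r wq assms(1) awalk_ends by (metis append_Nil2 list.distinct(1))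
    moreover have "?x \<in> set (map snd ?q)" by auto
    ultimately show False using dist by (metis UnCI distinct.simps(2) map_append set_append)
  qed
  then obtain g r' where g: "r = g # r'" by (cases r) auto
  have "awalk (last (pawalk_verts a ?q)) r a"
    using assms(1) r awalk_append_iff by metis
  then have fg: "fst g = ?x"
    using g last(2)[OF wq] by (simp add: awalk_Cons_iff)
  \<comment> \<open>The reverse of \<open>f\<close> would be an arc of \<open>p\<close> into
    \<open>?x\<close>, hence \<open>last ?q\<close>, as heads are distinct. So \<open>f\<close>
    would lead back to a vertex of the path.\<close>
  have "f \<notin> (set p)\<inverse>"
  proof
    assume "f \<in> (set p)\<inverse>"
    then have "(snd f, ?x) \<in> set p" using f by (cases f) auto
    moreover have "last ?q \<in> set p" using r by (metis UnCI last_in_set list.distinct(1) set_append)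
    ultimately have "(snd f, ?x) = last ?q"
      using dp(1) unfolding distinct_map by (metis inj_onD snd_conv)
    then have "snd f \<in> fst ` set ?q" by (metis fst_conv image_eqI last_in_set list.distinct(1))
    then have "snd f \<in> set (pawalk_verts a ?q)"
      using set_awalk_verts[OF wq] by auto
    then show False using dist last(1)[OF wq] by auto
  qed
  then have "f \<in> set p" using snoc.prems(2) by auto
  moreover have "g \<in> set p" using r g by auto
  \<comment> \<open>Both arcs of \<open>p\<close> leave \<open>?x\<close>, and tails are
    distinct.\<close>
  ultimately have "f = g" using dp(2) f fg unfolding distinct_map by (metis inj_onD)
  then show ?case using r g by simp
qed

text \<open>Restarting the cycle at the first arc of \<open>q\<close>, oriented as in
  \<open>q\<close>, makes \<open>q\<close> a prefix; \<open>r\<close> is what remains.\<close>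

lemma cycle_complement_of_path:
  assumes "awalk u p u" "cycle p" "apath a q b" "q \<noteq> []" "set q \<subseteq> set p \<union> (set p)\<inverse>"
  obtains r where "awalk b r a" "cycle (q @ r)" "length (q @ r) = length p"
    "walk_graph a (q @ r) = walk_graph u p"
proof -
  obtain e q' where q: "q = e # q'" using assms(4) by (cases q) auto
  then have a: "a = fst e" using assms(3) by (simp add: apath_Cons_iff)
  obtain p' where p': "awalk a (e # p') a" "cycle (e # p')"
    "length (e # p') = length p" "walk_graph a (e # p') = walk_graph u p"
    using cycle_start_with_edge[OF assms(1,2), of e] assms(5) q a by auto
  have "set (e # p') \<union> (set (e # p'))\<inverse> = set p \<union> (set p)\<inverse>"
    using p'(4) by (simp add: walk_graph_def)
  then obtain r where r: "e # p' = q @ r"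
    using path_prefix_of_cycle[OF p'(1,2) refl, of q' b] assms(3,5) q by auto
  have "last (pawalk_verts a q) = b"
    using assms(3) by (auto simp: apath_def)
  then have "awalk b r a"
    using p'(1) unfolding r by simp
  then show ?thesis using that p' r by simp
qed

text \<open>By \<open>meet\<close>, a vertex common to \<open>r\<close> and \<open>s\<close> lies on
  \<open>q\<close>, which each of them touches only at \<open>a\<close> and \<open>b\<close>. If
  both are the single arc from \<open>b\<close> to \<open>a\<close>, the result has two arcs and
  still satisfies \<open>cycle\<close>; the bound on the length is left to the caller.\<close>

lemma theta_third_cycle:
  assumes q: "apath a q b" "q \<noteq> []"
    and r: "awalk b r a" "cycle (q @ r)"
    and s: "awalk b s a" "cycle (q @ s)"
    and meet: "snd ` set (q @ r) \<inter> snd ` set (q @ s) \<subseteq> set (pawalk_verts a q)"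
  shows "awalk b (r @ rev_path s) b" "cycle (r @ rev_path s)"
proof -
  have wq: "awalk a q b" using q(1) by (rule awalkI_apath)
  have ab: "a \<noteq> b" using q by (rule apath_nonempty_ends)
  show w: "awalk b (r @ rev_path s) b"
    using r(1) s(1) by (intro awalk_appendI) auto
  have vq: "pawalk_verts a q = a # map snd q"
    using wq by (auto simp: awalk_def pawalk_verts_eq_Cons)
  have dr: "distinct (map snd (q @ r))"
    using r cycle_conv_heads[OF awalk_appendI[OF wq r(1)]] by auto
  have ds: "distinct (map snd (q @ s))" "distinct (map fst (q @ s))"
    using s cycle_conv_heads[OF awalk_appendI[OF wq s(1)]]
      distinct_tails_if_cycle[OF awalk_appendI[OF wq s(1)]] by auto
  have "r \<noteq> []" using ab r(1) by (auto simp: awalk_Nil_iff)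
  have tails: "insert a (fst ` set s) = insert b (snd ` set s)"
    using s(1) arg_cong[OF mset_tails_heads[of b s a], of set_mset]
    by (auto simp: awalk_def)
  have "a \<in> fst ` set q"
    using wq q(2) by (cases q) (auto simp: awalk_Cons_iff)
  then have a: "a \<notin> fst ` set s" using ds(2) by auto
  have "b \<in> snd ` set q"
    using wq ab mset_tails_heads[of a q b] by (auto simp: awalk_def dest!: arg_cong[of _ _ set_mset])
  then have b: "b \<notin> snd ` set r" using dr by auto
  \<comment> \<open>The heads of \<open>rev_path s\<close> are the tails of \<open>s\<close>, so
    this is the disjointness needed for the joined walk. As \<open>x\<close> differs from
    \<open>b\<close>, it is a head of \<open>s\<close> too, and \<open>meet\<close> applies.\<close>
  have "x \<notin> fst ` set s" if x: "x \<in> snd ` set r" for x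
  proof
    assume xs: "x \<in> fst ` set s"
    then have "x \<in> snd ` set s" using tails x b by auto
    then have "x \<in> set (pawalk_verts a q)" using meet x by auto
    moreover have "x \<notin> snd ` set q" using x dr by auto
    ultimately have "x = a" using vq by auto
    then show False using xs a by simp
  qed
  moreover have "map snd (rev_path s) = rev (map fst s)"
    by (simp add: rev_path_conv rev_map)
  ultimately have "distinct (map snd (r @ rev_path s))"
    using dr ds by (auto simp flip: set_map)
  then show "cycle (r @ rev_path s)"
    using cycle_conv_heads[OF w] \<open>r \<noteq> []\<close> by simp
qed

end

theorem theorem20:
  fixes G :: "'a pair_pre_digraph"
  assumes "G \<in> eps13"
  shows "\<not> (\<exists>m n t C D. cycle_in m C G \<and> cycle_in n D G \<and> C \<noteq> D
            \<and> 0 < t \<and> path_in t (graph_inter C D) G)"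
proof
  assume "\<exists>m n t C D. cycle_in m C G \<and> cycle_in n D G \<and> C \<noteq> D
            \<and> 0 < t \<and> path_in t (graph_inter C D) G"
  then obtain m n t C D where C: "cycle_in m C G" and D: "cycle_in n D G" and "C \<noteq> D"
    and "0 < t" and P: "path_in t (graph_inter C D) G" by blast
  interpret pair_graph G using assms by (simp add: eps13_def euler_graph_def)
  have odd: "odd k" if "cycle_in k E G" for k E
  proof -
    have "k mod 4 = 1 \<or> k mod 4 = 3" using assms that by (auto simp: eps13_def)
    then show ?thesis by presburger
  qed
  obtain u p where p: "awalk u p u" "cycle p" "length p = m" "C = walk_graph u p"
    using C by (auto simp: cycle_in_def)
  obtain v p' where p': "awalk v p' v" "cycle p'" "length p' = n" "D = walk_graph v p'"
    using D by (auto simp: cycle_in_def)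
  obtain a q b where q: "apath a q b" "length q = t" "graph_inter C D = walk_graph a q"
    using P by (auto simp: path_in_def)
  have "q \<noteq> []" using q(2) \<open>0 < t\<close> by auto
  have "set q \<subseteq> parcs C" "set q \<subseteq> parcs D"
    and meet: "pverts C \<inter> pverts D = set (pawalk_verts a q)"
    using q(3) by (auto simp: graph_inter_def walk_graph_def)
  then have sub: "set q \<subseteq> set p \<union> (set p)\<inverse>" "set q \<subseteq> set p' \<union> (set p')\<inverse>"
    using p(4) p'(4) by (auto simp: walk_graph_def)
  obtain r where r: "awalk b r a" "cycle (q @ r)" "length (q @ r) = m" "walk_graph a (q @ r) = C"
    using cycle_complement_of_path[OF p(1,2) q(1) \<open>q \<noteq> []\<close> sub(1)] p(3,4) by metis
  obtain s where s: "awalk b s a" "cycle (q @ s)" "length (q @ s) = n" "walk_graph a (q @ s) = D"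
    using cycle_complement_of_path[OF p'(1,2) q(1) \<open>q \<noteq> []\<close> sub(2)] p'(3,4) by metis
  \<comment> \<open>Written as sets of heads, the vertex sets turn the assumption on the
    intersection into the form that \<open>theta_third_cycle\<close> expects.\<close>
  have "pverts C = snd ` set (q @ r)" "pverts D = snd ` set (q @ s)"
    using walk_graph_closed[of a "q @ r"] walk_graph_closed[of a "q @ s"] r s \<open>q \<noteq> []\<close>
      awalk_appendI[OF awalkI_apath[OF q(1)] r(1)] awalk_appendI[OF awalkI_apath[OF q(1)] s(1)]
    by (auto simp: awalk_def)
  then have "snd ` set (q @ r) \<inter> snd ` set (q @ s) \<subseteq> set (pawalk_verts a q)"
    using meet by simp
  note third = theta_third_cycle[OF q(1) \<open>q \<noteq> []\<close> r(1,2) s(1,2) this]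
  have len: "length (r @ rev_path s) = length r + length s"
    by (simp add: rev_path_conv)
  \<comment> \<open>The lengths \<open>t + length r\<close> and \<open>t + length s\<close> are both
    odd.\<close>
  have "even (length r + length s)"
    using odd[OF C] odd[OF D] r(3) s(3) by auto
  moreover have "a \<noteq> b" using q(1) \<open>q \<noteq> []\<close> by (rule apath_nonempty_ends)
  then have "0 < length r" "0 < length s" using r(1) s(1) by (auto simp: awalk_Nil_iff)
  moreover have "\<not> 3 \<le> length r + length s"
  proof
    assume "3 \<le> length r + length s"
    then have "cycle_in (length r + length s) (walk_graph b (r @ rev_path s)) G"
      unfolding cycle_in_def using third len by blast
    then show False using odd calculation(1) by blast
  qed
  \<comment> \<open>Two positive numbers with sum below 3.\<close>
  ultimately have "length r = 1" "length s = 1"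
    by linarith+
  \<comment> \<open>Both complements are the same arc, so \<open>q @ r\<close> and
    \<open>q @ s\<close> coincide and \<open>C = D\<close>.\<close>
  then have "r = [(b, a)]" "s = [(b, a)]"
    using r(1) s(1) by (auto simp: length_Suc_conv awalk_simps)
  then show False using r(4) s(4) \<open>C \<noteq> D\<close> by simp
qed

end
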